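(* Let $n\ge1$ and let $\mathcal{G}$ be a CGFT graph with $n+1$ colors (possibly with external halflines) with active and passive lines, $\mathcal{L}(\mathcal{G})=\mathcal{L}_1(\mathcal{G})\cup\mathcal{L}_2(\mathcal{G})$, where $\mathcal{L}_1(\mathcal{G})$ is the set of active lines and $\mathcal{L}_2(\mathcal{G})$ the set of passive lines. Let $\{\beta\}=\{\beta_{l'}\}_{l'\in\mathcal{L}_1(\mathcal{G})}$, $\{x_p\}_{0\le p\le n+1}$ and $\{y_p\}_{0\le p\le n}$ be variables, and let $$P_{\mathcal{G}}(\{\beta\},\{x_p\},\{y_p\})=\sum_{\mathcal{H}\subset\mathcal{G};\ \mathcal{L}_2(\mathcal{H})=\mathcal{L}_2(\mathcal{G})}\Big(\prod_{l'\in\mathcal{L}_1(\mathcal{H})}\beta_{l'}\Big)\prod_{p=0}^{n+1}x_p^{|\mathfrak{B}^p(\mathcal{H})|}\prod_{p=0}^{n}y_p^{|\mathfrak{B}^p_{\partial}(\mathcal{H})|}$$ be the topological polynomial of $\mathcal{G}$, where $\mathfrak{B}^p(\mathcal{H})$ and $\mathfrak{B}^p_{\partial}(\mathcal{H})$ are the sets of bulk and boundary $p$-cells of the subgraph $\mathcal{H}$. Then for every active line $l\in\mathcal{L}_1(\mathcal{G})$, $$P_{\mathcal{G}}(\{\beta\},\{x_p\},\{y_p\})=\beta_l\,P_{\mathcal{G}/l}(\{\beta\}\setminus\{\beta_l\},\{x_p\},\{y_p\})+P_{\mathcal{G}-l}(\{\beta\}\setminus\{\beta_l\},\{x_p\},\{y_p\}),$$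 where $\mathcal{G}/l$ is $\mathcal{G}$ with $l$ contracted (that is, turned from active into passive) and $\mathcal{G}-l$ is $\mathcal{G}$ with $l$ deleted.
   Context: CGFT graph with $n+1$ colors: a finite graph (multiple lines allowed) whose vertex set is a disjoint union of positive and negative vertices, in which every line joins a positive vertex to a negative vertex and carries a color in $\{0,\dots,n\}$. Vertices may also carry external halflines (attached to a single vertex), each with a color in $\{0,\dots,n\}$. At each vertex, each color in $\{0,\dots,n\}$ appears exactly once among the lines and halflines touching it. Active and passive lines: a colored graph with active and passive lines is a CGFT graph $\mathcal{G}$ with a partition $\mathcal{L}(\mathcal{G})=\mathcal{L}_1(\mathcal{G})\cup\mathcal{L}_2(\mathcal{G})$ of its lines into active lines $\mathcal{L}_1$ and passive lines $\mathcal{L}_2$, with $\mathcal{L}_2(\mathcal{G})$ a forest (no loops). The formula defining $P$ makes sense for any partition, and is used for $\mathcal{G}/l$ whether or not $\mathcal{L}_2(\mathcal{G})\cup\{l\}$ is a forest. Subgraphs: $\mathcal{H}\subset\mathcal{G}$ means that $\mathcal{H}$ has the same vertices as $\mathcal{G}$, a subset of its lines (each keeping its active/passive status), all halflines of $\mathcal{G}$, and each line of $\mathcal{G}$ not in $\mathcal{H}$ is replaced by two external halflines of the same color, one on each of its end vertices. Thus $\mathcal{H}$ is again a CGFT graph. Deletion and contraction, for an active line $l$: $\mathcal{G}-l$ has the same vertices, $\mathcal{L}_1(\mathcal{G}-l)=\mathcal{L}_1(\mathcal{G})\setminus\{l\}$, $\mathcal{L}_2(\mathcal{G}-l)=\mathcal{L}_2(\mathcal{G})$,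 with $l$ replaced by two halflines of the same color on its end vertices. $\mathcal{G}/l$ has the same vertices and lines as $\mathcal{G}$, with $\mathcal{L}_1(\mathcal{G}/l)=\mathcal{L}_1(\mathcal{G})\setminus\{l\}$ and $\mathcal{L}_2(\mathcal{G}/l)=\mathcal{L}_2(\mathcal{G})\cup\{l\}$. Bulk cells of a CGFT graph $\mathcal{H}$: for $0\le p\le n$, $\mathfrak{B}^p(\mathcal{H})$ is the set of (internal) $p$-bubbles, i.e. pairs of a color set $\mathcal{C}\subset\{0,\dots,n\}$ with $|\mathcal{C}|=p$ and a maximal connected component of the graph on all vertices of $\mathcal{H}$ with only the lines of colors in $\mathcal{C}$, such that no vertex of the component carries an external halfline with color in $\mathcal{C}$. In particular the $0$-bubbles are the vertices and the $1$-bubbles are the lines. $\mathfrak{B}^{n+1}(\mathcal{H})$ is the set of all connected components of $\mathcal{H}$ (with or without halflines). Boundary graph $\mathcal{H}_{\partial}$: for each pair of colors $\{i,j\}$, the maximal connected components of the graph on all vertices of $\mathcal{H}$ with only the lines of colors $i$ and $j$ are cycles (closed strands) or paths, possibly a single vertex (open strands of colors $ij$). An open strand of colors $ij$ ends on exactly two distinct external halflines of color $i$ or $j$, located at the end vertices of the path (both at the same vertex if the path is a single vertex). $\mathcal{H}_{\partial}$ has one vertex for each external halfline of $\mathcal{H}$, carrying its color, and one line for each open strand, joining the vertices of the two halflines on which it ends and carrying the couple of colors $ij$. Boundary cells: $\mathfrak{B}^0_{\partial}(\mathcal{H})$ is the set of vertices of $\mathcal{H}_{\partial}$. For $1\le p\le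 n-1$, $\mathfrak{B}^p_{\partial}(\mathcal{H})$ is the set of pairs of a color set $\mathcal{C}\subset\{0,\dots,n\}$ with $|\mathcal{C}|=p+1$ and a maximal connected component of the graph formed by the vertices of $\mathcal{H}_{\partial}$ with color in $\mathcal{C}$ and the lines of $\mathcal{H}_{\partial}$ whose couple of colors is contained in $\mathcal{C}$. $\mathfrak{B}^n_{\partial}(\mathcal{H})$ is the set of connected components of $\mathcal{H}_{\partial}$. *)

theory Defs
  imports Main "HOL-Library.FuncSet"
begin

text \<open>
  Since a colour occurs only once at each vertex, an external halfline is determined by its vertex
  and its colour, and is represented by that pair.
\<close>

record ('v, 'l) cgft_graph =
  pos_verts :: "'v set"
  neg_verts :: "'v set"
  lines :: "'l set"
  pos_end :: "'l \<Rightarrow> 'v"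
  neg_end :: "'l \<Rightarrow> 'v"
  col :: "'l \<Rightarrow> nat"
  halflines :: "('v \<times> nat) set"

definition verts :: "('v, 'l, 'z) cgft_graph_scheme \<Rightarrow> 'v set" where
  "verts G = pos_verts G \<union> neg_verts G"

definition line_ends :: "('v, 'l, 'z) cgft_graph_scheme \<Rightarrow> 'l \<Rightarrow> 'v set" where
  "line_ends G l = {pos_end G l, neg_end G l}"

definition line_halves :: "('v, 'l, 'z) cgft_graph_scheme \<Rightarrow> 'l \<Rightarrow> ('v \<times> nat) set" where
  "line_halves G l = {(pos_end G l, col G l), (neg_end G l, col G l)}"

locale cgft =
  fixes n :: nat and G :: "('v, 'l, 'z) cgft_graph_scheme"
  assumes finite_verts: "finite (verts G)"
    and finite_lines: "finite (lines G)"
    and pos_neg_disjoint: "pos_verts G \<inter> neg_verts G = {}"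
    and pos_end_in: "l \<in> lines G \<Longrightarrow> pos_end G l \<in> pos_verts G"
    and neg_end_in: "l \<in> lines G \<Longrightarrow> neg_end G l \<in> neg_verts G"
    and col_le: "l \<in> lines G \<Longrightarrow> col G l \<le> n"
    and halflines_subset: "halflines G \<subseteq> verts G \<times> {..n}"
    and each_colour_once: "\<lbrakk>v \<in> verts G; c \<le> n\<rbrakk> \<Longrightarrow>
      card {l \<in> lines G. v \<in> line_ends G l \<and> col G l = c} + card (halflines G \<inter> {(v, c)}) = 1"

record ('v, 'l) ap_graph = "('v, 'l) cgft_graph" +
  active_lines :: "'l set"
  passive_lines :: "'l set"

definition is_cycle ::
    "('v, 'l, 'z) cgft_graph_scheme \<Rightarrow> 'v list \<Rightarrow> 'l list \<Rightarrow> bool" where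
  "is_cycle G vs ls \<longleftrightarrow>
     ls \<noteq> [] \<and> length vs = length ls \<and> distinct vs \<and> distinct ls \<and>
     (\<forall>i < length ls. line_ends G (ls ! i) = {vs ! i, vs ! (Suc i mod length vs)})"

definition is_forest :: "('v, 'l, 'z) cgft_graph_scheme \<Rightarrow> 'l set \<Rightarrow> bool" where
  "is_forest G F \<longleftrightarrow> \<not> (\<exists>vs ls. is_cycle G vs ls \<and> set ls \<subseteq> F)"

locale active_passive_graph = cgft n G
  for n :: nat and G :: "('v, 'l) ap_graph" +
  assumes active_un_passive: "lines G = active_lines G \<union> passive_lines G"
    and active_passive_disjoint: "active_lines G \<inter> passive_lines G = {}"
    and passive_forest: "is_forest G (passive_lines G)"

text \<open>
  The end and colour maps are required to agree everywhere, not only on lines, so that a subgraph is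
  determined by its set of lines.
\<close>

definition is_subgraph :: "('v, 'l) ap_graph \<Rightarrow> ('v, 'l) ap_graph \<Rightarrow> bool" where
  "is_subgraph H G \<longleftrightarrow>
     pos_verts H = pos_verts G \<and> neg_verts H = neg_verts G \<and>
     pos_end H = pos_end G \<and> neg_end H = neg_end G \<and> col H = col G \<and>
     lines H \<subseteq> lines G \<and>
     active_lines H = active_lines G \<inter> lines H \<and> passive_lines H = passive_lines G \<inter> lines H \<and>
     halflines H = halflines G \<union> (\<Union>l \<in> lines G - lines H. line_halves G l)"

definition delete_line :: "('v, 'l) ap_graph \<Rightarrow> 'l \<Rightarrow> ('v, 'l) ap_graph" where
  "delete_line G l = G\<lparr>lines := lines G - {l}, active_lines := active_lines G - {l},
     halflines := halflines G \<union> line_halves G l\<rparr>"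

definition contract_line :: "('v, 'l) ap_graph \<Rightarrow> 'l \<Rightarrow> ('v, 'l) ap_graph" where
  "contract_line G l = G\<lparr>active_lines := active_lines G - {l},
     passive_lines := insert l (passive_lines G)\<rparr>"

text \<open>
  Connected components of the graph with vertex set \<open>V\<close> and adjacency \<open>R\<close>, given by their vertex
  sets.
\<close>

definition graph_components :: "'a set \<Rightarrow> ('a \<times> 'a) set \<Rightarrow> 'a set set" where
  "graph_components V R = V // {(u, v) \<in> V \<times> V. (u, v) \<in> (R \<union> R\<inverse>)\<^sup>*}"

definition colour_components ::
    "('v, 'l, 'z) cgft_graph_scheme \<Rightarrow> nat set \<Rightarrow> 'v set set" where
  "colour_components G C =
     graph_components (verts G) {(pos_end G l, neg_end G l) | l. l \<in> lines G \<and> col G l \<in> C}"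

text \<open>
  For \<open>p = n + 1\<close> the only choice of \<open>C\<close> is \<open>{..n}\<close>, and components with halflines are counted too.
\<close>

definition bulk_cells ::
    "nat \<Rightarrow> nat \<Rightarrow> ('v, 'l, 'z) cgft_graph_scheme \<Rightarrow> (nat set \<times> 'v set) set" where
  "bulk_cells n p G = {(C, S). C \<subseteq> {..n} \<and> card C = p \<and> S \<in> colour_components G C \<and>
     (p \<le> n \<longrightarrow> (\<forall>v \<in> S. \<forall>c \<in> C. (v, c) \<notin> halflines G))}"

definition is_path_component ::
    "('v, 'l, 'z) cgft_graph_scheme \<Rightarrow> nat set \<Rightarrow> 'v set \<Rightarrow> bool" where
  "is_path_component G C S \<longleftrightarrow> S \<in> colour_components G C \<and>
     (\<exists>vs ls. length vs = Suc (length ls) \<and> distinct vs \<and> distinct ls \<and> set vs = S \<and>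
        set ls = {l \<in> lines G. col G l \<in> C \<and> line_ends G l \<subseteq> S} \<and>
        (\<forall>i < length ls. line_ends G (ls ! i) = {vs ! i, vs ! Suc i}))"

definition open_strands ::
    "nat \<Rightarrow> ('v, 'l, 'z) cgft_graph_scheme \<Rightarrow> (nat set \<times> 'v set) set" where
  "open_strands n G =
     {({i, j}, S) | i j S. i \<le> n \<and> j \<le> n \<and> i \<noteq> j \<and> is_path_component G {i, j} S}"

text \<open>
  In a CGFT graph, inner vertices of the path \<open>S\<close> meet lines of both colours in \<open>C\<close>, so the halflines
  below sit on its two end vertices and there are exactly two of them.
\<close>

definition strand_ends ::
    "('v, 'l, 'z) cgft_graph_scheme \<Rightarrow> nat set \<times> 'v set \<Rightarrow> ('v \<times> nat) set" where
  "strand_ends G = (\<lambda>(C, S). {(v, c) \<in> halflines G. v \<in> S \<and> c \<in> C})"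

record ('a, 'b) boundary_graph =
  bverts :: "'a set"
  bcol :: "'a \<Rightarrow> nat"
  blines :: "'b set"
  bends :: "'b \<Rightarrow> 'a set"
  bcouple :: "'b \<Rightarrow> nat set"

definition boundary ::
    "nat \<Rightarrow> ('v, 'l, 'z) cgft_graph_scheme \<Rightarrow> ('v \<times> nat, nat set \<times> 'v set) boundary_graph" where
  "boundary n G = \<lparr>bverts = halflines G, bcol = snd, blines = open_strands n G,
     bends = strand_ends G, bcouple = fst\<rparr>"

definition boundary_components :: "('a, 'b) boundary_graph \<Rightarrow> nat set \<Rightarrow> 'a set set" where
  "boundary_components B C = graph_components {h \<in> bverts B. bcol B h \<in> C}
     {(h, h'). \<exists>s \<in> blines B. bcouple B s \<subseteq> C \<and> bends B s = {h, h'}}"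

text \<open>
  To have one type for all \<open>p\<close>, a vertex \<open>h\<close> of the boundary graph is stored as
  \<open>({bcol B h}, {h})\<close>. For \<open>p = n\<close> the colour set \<open>{..n}\<close> imposes no restriction.
\<close>

definition boundary_cells ::
    "nat \<Rightarrow> nat \<Rightarrow> ('v, 'l, 'z) cgft_graph_scheme \<Rightarrow> (nat set \<times> ('v \<times> nat) set) set" where
  "boundary_cells n p G = (let B = boundary n G in
     if p = 0 then (\<lambda>h. ({bcol B h}, {h})) ` bverts B
     else {(C, S). C \<subseteq> {..n} \<and> card C = p + 1 \<and> S \<in> boundary_components B C})"

text \<open>
  The variables take values in an arbitrary commutative ring, which includes the case of formal
  indeterminates.
\<close>

definition topo_poly ::
    "nat \<Rightarrow> ('v, 'l) ap_graph \<Rightarrow> ('l \<Rightarrow> 'r) \<Rightarrow> (nat \<Rightarrow> 'r) \<Rightarrow> (nat \<Rightarrow> 'r) \<Rightarrow> 'r::comm_ring_1" where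
  "topo_poly n G \<beta> x y =
     (\<Sum>H | is_subgraph H G \<and> passive_lines H = passive_lines G.
        (\<Prod>l \<in> active_lines H. \<beta> l) *
        (\<Prod>p = 0..n + 1. x p ^ card (bulk_cells n p H)) *
        (\<Prod>p = 0..n. y p ^ card (boundary_cells n p H)))"

end

theory Submission
  imports Defs
begin

text \<open>
  A subgraph containing all passive lines is determined by its set \<open>A\<close> of active lines, so the
  polynomial is a sum over \<open>A \<subseteq> active_lines G\<close>. The sets containing \<open>l\<close> give the contraction term,
  since the cells do not see which lines are active, and the other sets give the deletion term.
\<close>

text \<open>Written as an update of \<open>G\<close>, so that vertices, end maps, colours and
  passive lines are inherited.\<close>

definition spanning_subgraph :: "('v, 'l) ap_graph \<Rightarrow> 'l set \<Rightarrow> ('v, 'l) ap_graph" where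
  "spanning_subgraph G A = G\<lparr>lines := A \<union> passive_lines G, active_lines := A,
     halflines := halflines G \<union> (\<Union>l \<in> lines G - (A \<union> passive_lines G). line_halves G l)\<rparr>"

text \<open>The part of a summand of \<open>topo_poly\<close> that depends only on the underlying
  CGFT graph, separated from the \<open>\<beta>\<close> factors, which do depend on which lines are
  active.\<close>

definition cell_weight ::
    "nat \<Rightarrow> ('v, 'l) ap_graph \<Rightarrow> (nat \<Rightarrow> 'r) \<Rightarrow> (nat \<Rightarrow> 'r) \<Rightarrow> 'r::comm_ring_1" where
  "cell_weight n H x y =
     (\<Prod>p = 0..n + 1. x p ^ card (bulk_cells n p H)) *
     (\<Prod>p = 0..n. y p ^ card (boundary_cells n p H))"

lemma active_lines_spanning_subgraph [simp]: "active_lines (spanning_subgraph G A) = A"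
  by (simp add: spanning_subgraph_def)

text \<open>The partition forces \<open>lines H = active_lines H \<union> passive_lines G\<close>,
  and \<open>is_subgraph\<close> fixes every other field of \<open>H\<close> in terms of
  \<open>G\<close> and \<open>lines H\<close>. The witness is therefore
  \<open>active_lines H\<close>.\<close>

lemma is_subgraph_iff_spanning_subgraph:
  assumes "lines G = active_lines G \<union> passive_lines G"
    and "active_lines G \<inter> passive_lines G = {}"
  shows "is_subgraph H G \<and> passive_lines H = passive_lines G \<longleftrightarrow>
    (\<exists>A \<subseteq> active_lines G. H = spanning_subgraph G A)"
proof
  assume H: "is_subgraph H G \<and> passive_lines H = passive_lines G"
  then have eqs: "pos_verts H = pos_verts G" "neg_verts H = neg_verts G" "pos_end H = pos_end G"
      "neg_end H = neg_end G" "col H = col G" "passive_lines H = passive_lines G"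
      "halflines H = halflines G \<union> (\<Union>l \<in> lines G - lines H. line_halves G l)"
    and lns: "lines H \<subseteq> lines G" "active_lines H = active_lines G \<inter> lines H"
      "passive_lines H = passive_lines G \<inter> lines H"
    unfolding is_subgraph_def by iprover+
  have lines_H: "lines H = active_lines H \<union> passive_lines G"
    and "active_lines H \<subseteq> active_lines G"
    using assms(1) lns eqs(6) by blast+
  moreover have "H = spanning_subgraph G (active_lines H)"
    by (intro ap_graph.equality) (simp_all add: spanning_subgraph_def eqs lines_H)
  ultimately show "\<exists>A \<subseteq> active_lines G. H = spanning_subgraph G A" by blast
next
  assume "\<exists>A \<subseteq> active_lines G. H = spanning_subgraph G A"
  then show "is_subgraph H G \<and> passive_lines H = passive_lines G"
    using assms by (auto simp: is_subgraph_def spanning_subgraph_def)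
qed

text \<open>Stated for an arbitrary partition of the lines, so that it also applies to
  \<open>contract_line G l\<close>, whose passive lines may contain a cycle.\<close>

lemma topo_poly_eq_sum_Pow:
  assumes "lines G = active_lines G \<union> passive_lines G"
    and "active_lines G \<inter> passive_lines G = {}"
  shows "topo_poly n G \<beta> x y =
    (\<Sum>A \<in> Pow (active_lines G). (\<Prod>l \<in> A. \<beta> l) * cell_weight n (spanning_subgraph G A) x y)"
proof -
  have "{H. is_subgraph H G \<and> passive_lines H = passive_lines G} =
      spanning_subgraph G ` Pow (active_lines G)"
    unfolding is_subgraph_iff_spanning_subgraph[OF assms] by blast
  \<comment> \<open>\<open>active_lines\<close> is a left inverse.\<close>
  moreover have "inj_on (spanning_subgraph G) (Pow (active_lines G))"
    by (metis active_lines_spanning_subgraph inj_onI)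
  ultimately show ?thesis
    by (simp add: topo_poly_def cell_weight_def sum.reindex mult.assoc)
qed

text \<open>Cells are built from vertices, lines, end maps, colours and halflines alone; the
  invariance is carried through the definitions from colour components up to the boundary
  graph.\<close>

lemma cell_weight_update_active_passive:
  "cell_weight n (H\<lparr>active_lines := A, passive_lines := P\<rparr>) x y = cell_weight n H x y"
proof -
  let ?H = "H\<lparr>active_lines := A, passive_lines := P\<rparr>"
  have comps: "colour_components ?H = colour_components H"
    by (simp add: fun_eq_iff colour_components_def verts_def)
  have ends: "line_ends ?H = line_ends H"
    by (simp add: fun_eq_iff line_ends_def)
  have bulk: "bulk_cells n p ?H = bulk_cells n p H" for p
    by (simp add: bulk_cells_def comps)
  have "is_path_component ?H = is_path_component H"
    by (simp add: fun_eq_iff is_path_component_def comps ends)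
  then have "boundary n ?H = boundary n H"
    by (simp add: boundary_def open_strands_def strand_ends_def)
  then show ?thesis
    by (simp add: cell_weight_def bulk boundary_cells_def)
qed

text \<open>Both graphs keep the same lines, hence cut the same halflines; only the label of
  \<open>l\<close> differs.\<close>

lemma cell_weight_contract_line:
  "cell_weight n (spanning_subgraph (contract_line G l) A) x y =
   cell_weight n (spanning_subgraph G (insert l A)) x y"
proof -
  have "spanning_subgraph (contract_line G l) A =
      (spanning_subgraph G (insert l A))
        \<lparr>active_lines := A, passive_lines := insert l (passive_lines G)\<rparr>"
    by (simp add: spanning_subgraph_def contract_line_def line_halves_def)
  then show ?thesis by (simp only: cell_weight_update_active_passive)
qed

text \<open>The halflines that deletion adds are exactly those that
  \<open>spanning_subgraph G A\<close> creates for the omitted line \<open>l\<close>.\<close>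

lemma spanning_subgraph_delete_line:
  assumes "l \<in> lines G" "l \<notin> passive_lines G" "l \<notin> A"
  shows "spanning_subgraph (delete_line G l) A = spanning_subgraph G A"
proof -
  have "lines G - (A \<union> passive_lines G) =
      insert l (lines G - {l} - (A \<union> passive_lines G))"
    using assms by blast
  then show ?thesis
    by (simp add: spanning_subgraph_def delete_line_def line_halves_def Un_assoc)
qed

text \<open>Subsets of \<open>insert a A\<close> are split by whether they contain \<open>a\<close>;
  those that do correspond bijectively to subsets of \<open>A\<close>.\<close>

lemma sum_Pow_insert:
  assumes "finite A" "a \<notin> A"
  shows "sum f (Pow (insert a A)) = (\<Sum>B \<in> Pow A. f (insert a B)) + sum f (Pow A)"
proof -
  have "inj_on (insert a) (Pow A)"
    using assms(2) by (intro inj_onI) (metis PowD insert_ident subsetD)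
  then have "sum f (insert a ` Pow A) = (\<Sum>B \<in> Pow A. f (insert a B))"
    by (simp add: sum.reindex)
  moreover have "Pow A \<inter> insert a ` Pow A = {}"
    using assms(2) by blast
  ultimately show ?thesis
    using assms(1) by (simp add: Pow_insert sum.union_disjoint add.commute)
qed

theorem lemma4:
  fixes n :: nat and G :: "('v, 'l) ap_graph" and l :: 'l
    and \<beta> :: "'l \<Rightarrow> 'r::comm_ring_1" and x y :: "nat \<Rightarrow> 'r"
  assumes "n \<ge> 1"
    and "active_passive_graph n G"
    and "l \<in> active_lines G"
  shows "topo_poly n G \<beta> x y =
      \<beta> l * topo_poly n (contract_line G l) (restrict \<beta> (active_lines G - {l})) x y
      + topo_poly n (delete_line G l) (restrict \<beta> (active_lines G - {l})) x y"
proof -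
  interpret active_passive_graph n G by fact
  \<comment> \<open>The common set of active lines of \<open>contract_line G l\<close> and
    \<open>delete_line G l\<close>.\<close>
  define A where "A = active_lines G - {l}"
  have active: "active_lines G = insert l A" and l_A: "l \<notin> A"
    using assms(3) by (auto simp: A_def)
  have l_G: "l \<in> lines G" "l \<notin> passive_lines G"
    using assms(3) active_un_passive active_passive_disjoint by auto
  have fin: "finite A"
    using finite_lines active_un_passive by (simp add: A_def)
  \<comment> \<open>Outside \<open>A\<close> the restricted function is \<open>undefined\<close>,
    but every factor has its index in \<open>B\<close>, a subset of \<open>A\<close>.\<close>
  have restr: "(\<Prod>k \<in> B. restrict \<beta> A k) = (\<Prod>k \<in> B. \<beta> k)" if "B \<in> Pow A" for B
    using that by (intro prod.cong) auto
  have ins: "(\<Prod>k \<in> insert l B. \<beta> k) = \<beta> l * (\<Prod>k \<in> B. \<beta> k)" if "B \<in> Pow A" for B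
    using that fin l_A by (subst prod.insert) (auto intro: finite_subset)
  have "topo_poly n (contract_line G l) (restrict \<beta> A) x y =
      (\<Sum>B \<in> Pow (active_lines (contract_line G l)).
        (\<Prod>k \<in> B. restrict \<beta> A k) * cell_weight n (spanning_subgraph (contract_line G l) B) x y)"
    \<comment> \<open>Moving \<open>l\<close> from the active to the passive lines preserves the
      partition.\<close>
    using active_un_passive active_passive_disjoint l_G
    by (intro topo_poly_eq_sum_Pow) (auto simp: contract_line_def)
  also have "\<dots> =
      (\<Sum>B \<in> Pow A. (\<Prod>k \<in> B. \<beta> k) * cell_weight n (spanning_subgraph G (insert l B)) x y)"
  proof (rule sum.cong)
    show "Pow (active_lines (contract_line G l)) = Pow A"
      by (simp add: contract_line_def A_def)
  qed (simp only: restr cell_weight_contract_line)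
  finally have "\<beta> l * topo_poly n (contract_line G l) (restrict \<beta> A) x y =
      (\<Sum>B \<in> Pow A. \<beta> l * ((\<Prod>k \<in> B. \<beta> k) *
        cell_weight n (spanning_subgraph G (insert l B)) x y))"
    by (simp only: sum_distrib_left)
  \<comment> \<open>Absorbing \<open>\<beta> l\<close> into the product gives the summand of
    \<open>G\<close> at \<open>insert l B\<close>, the form that \<open>sum_Pow_insert\<close>
    produces.\<close>
  then have contract: "\<beta> l * topo_poly n (contract_line G l) (restrict \<beta> A) x y =
      (\<Sum>B \<in> Pow A. (\<Prod>k \<in> insert l B. \<beta> k) *
        cell_weight n (spanning_subgraph G (insert l B)) x y)"
    by (simp add: ins mult.assoc)
  have "topo_poly n (delete_line G l) (restrict \<beta> A) x y =
      (\<Sum>B \<in> Pow (active_lines (delete_line G l)).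
        (\<Prod>k \<in> B. restrict \<beta> A k) * cell_weight n (spanning_subgraph (delete_line G l) B) x y)"
    using active_un_passive active_passive_disjoint l_G
    by (intro topo_poly_eq_sum_Pow) (auto simp: delete_line_def)
  also have "\<dots> =
      (\<Sum>B \<in> Pow A. (\<Prod>k \<in> B. \<beta> k) * cell_weight n (spanning_subgraph G B) x y)"
  proof (rule sum.cong)
    show "Pow (active_lines (delete_line G l)) = Pow A"
      by (simp add: delete_line_def A_def)
  next
    fix B assume B: "B \<in> Pow A"
    then have "spanning_subgraph (delete_line G l) B = spanning_subgraph G B"
      using l_A by (intro spanning_subgraph_delete_line l_G) auto
    with B show "(\<Prod>k \<in> B. restrict \<beta> A k) *
        cell_weight n (spanning_subgraph (delete_line G l) B) x y =
        (\<Prod>k \<in> B. \<beta> k) * cell_weight n (spanning_subgraph G B) x y"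
      by (simp only: restr)
  qed
  finally have delete: "topo_poly n (delete_line G l) (restrict \<beta> A) x y =
      (\<Sum>B \<in> Pow A. (\<Prod>k \<in> B. \<beta> k) * cell_weight n (spanning_subgraph G B) x y)" .
  have "topo_poly n G \<beta> x y =
      (\<Sum>B \<in> Pow (insert l A). (\<Prod>k \<in> B. \<beta> k) * cell_weight n (spanning_subgraph G B) x y)"
    using topo_poly_eq_sum_Pow[OF active_un_passive active_passive_disjoint]
    by (simp only: active)
  also have "\<dots> = \<beta> l * topo_poly n (contract_line G l) (restrict \<beta> A) x y
      + topo_poly n (delete_line G l) (restrict \<beta> A) x y"
    by (simp only: sum_Pow_insert[OF fin l_A] contract delete)
  finally show ?thesis by (simp only: A_def)
qed

end
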